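(* Let $\{X_i,i\geq 1\}$ be a sequence of negatively associated random variables with $\mathbb{E}X_i=0$ for all $i$, let $S_k=\sum_{i=1}^k X_i$, let $n\ge 1$, $0<\alpha<1$ and $p\in(0,1)$. Assume that there exists a constant $K_n\geq 1$ such that $$\sum_{i=1}^{n}\mathbb{E}[X_i^2\exp\{|X_i|^p\}]\leq K_n.$$ Then, for any $x>0$, $$\mathbb{P}\Big(\max_{1\leq k\leq n}S_k\geq x\Big)\leq \begin{cases} 2(1-\alpha)^{-1}\exp\left\{-\frac{\alpha^2x^2}{2K_n}\right\}&\text{if } 0\leq \alpha x\leq K_n^{\frac{1}{2-p}},\\ 2(1-\alpha)^{-1}\exp\left\{-\frac{\alpha^px^p}{2}\right\}&\text{if } \alpha x\geq K_n^{\frac{1}{2-p}}, \end{cases}$$ and the right-hand side is in turn $$\leq 2(1-\alpha)^{-1}\exp\left\{-\frac{\alpha^2x^2}{2(K_n+\alpha^{2-p}x^{2-p})}\right\}.$$ In particular, for any $x>0$, $$\mathbb{P}\Big(\max_{1\leq k\leq n}S_k\geq x\Big)\leq \begin{cases} 4\exp\left\{-\frac{x^2}{8K_n}\right\}&\text{if } 0\leq x\leq 2K_n^{\frac{1}{2-p}},\\ 4\exp\left\{-\frac{x^p}{2^{p+1}}\right\}&\text{if } x\geq 2K_n^{\frac{1}{2-p}}, \end{cases}$$ and the right-hand side is in turn $$\leq 4\exp\left\{-\frac{x^2}{8K_n+2^{p+1}x^{2-p}}\right\}.$$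
   Context: A finite family $\{X_i,1\leq i\leq n\}$ of random variables is negatively associated (NA) if for every pair of disjoint subsets $A_1,A_2$ of $\{1,\dots,n\}$, $\mathrm{Cov}\{f_1(X_i,i\in A_1),f_2(X_j,j\in A_2)\}\leq 0$ whenever $f_1$ and $f_2$ are coordinatewise increasing and the covariance exists. A sequence $\{X_i,i\ge1\}$ is NA if $X_1,\dots,X_n$ is NA for every $n\ge 2$. *)

theory Defs
  imports "HOL-Probability.Probability"
begin

definition covariance :: "'a measure \<Rightarrow> ('a \<Rightarrow> real) \<Rightarrow> ('a \<Rightarrow> real) \<Rightarrow> real" where
  "covariance M U V =
     (LINT \<omega>|M. (U \<omega> - (LINT \<omega>'|M. U \<omega>')) * (V \<omega> - (LINT \<omega>'|M. V \<omega>')))"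

(* Bochner integrability includes measurability, so this also says that U, V are random variables. *)
definition covariance_exists :: "'a measure \<Rightarrow> ('a \<Rightarrow> real) \<Rightarrow> ('a \<Rightarrow> real) \<Rightarrow> bool" where
  "covariance_exists M U V \<longleftrightarrow>
     integrable M U \<and> integrable M V \<and> integrable M (\<lambda>\<omega>. U \<omega> * V \<omega>)"

(* Points of R^A are the extensional functions in A \<rightarrow>\<^sub>E UNIV;
   "increasing" is understood in the weak sense. *)
definition coordinatewise_increasing :: "nat set \<Rightarrow> ((nat \<Rightarrow> real) \<Rightarrow> real) \<Rightarrow> bool" where
  "coordinatewise_increasing A f \<longleftrightarrow>
     (\<forall>u \<in> A \<rightarrow>\<^sub>E UNIV. \<forall>i\<in>A. mono (\<lambda>c. f (u(i := c))))"

definition negatively_associated :: "'a measure \<Rightarrow> nat \<Rightarrow> (nat \<Rightarrow> 'a \<Rightarrow> real) \<Rightarrow> bool" where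
  "negatively_associated M n X \<longleftrightarrow>
     (\<forall>i\<in>{1..n}. X i \<in> borel_measurable M) \<and>
     (\<forall>A1 A2 f1 f2.
        A1 \<subseteq> {1..n} \<and> A2 \<subseteq> {1..n} \<and> A1 \<inter> A2 = {} \<and>
        coordinatewise_increasing A1 f1 \<and> coordinatewise_increasing A2 f2 \<and>
        covariance_exists M (\<lambda>\<omega>. f1 (\<lambda>i\<in>A1. X i \<omega>)) (\<lambda>\<omega>. f2 (\<lambda>j\<in>A2. X j \<omega>)) \<longrightarrow>
        covariance M (\<lambda>\<omega>. f1 (\<lambda>i\<in>A1. X i \<omega>)) (\<lambda>\<omega>. f2 (\<lambda>j\<in>A2. X j \<omega>)) \<le> 0)"

(* The sequence is X 1, X 2, ...; the value X 0 plays no role. *)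
definition negatively_associated_seq :: "'a measure \<Rightarrow> (nat \<Rightarrow> 'a \<Rightarrow> real) \<Rightarrow> bool" where
  "negatively_associated_seq M X \<longleftrightarrow> (\<forall>n\<ge>2. negatively_associated M n X)"

end

theory Submission
  imports Defs
begin

text \<open>
  Truncate from above, \<open>Y\<^sub>i = min X\<^sub>i y\<close>, and let \<open>G\<^sub>k = max 0 (Y\<^sub>k + G\<^sub>k\<^sub>+\<^sub>1)\<close> with
  \<open>G\<^sub>n\<^sub>+\<^sub>1 = 0\<close>; then \<open>G\<^sub>1\<close> dominates every partial sum of the \<open>Y\<^sub>i\<close>. Writing \<open>(a + b - r)\<^sup>+\<close> as the
  length of \<open>{s. r - b \<le> s < a}\<close>, negative association of the increasing indicators
  \<open>Y\<^sub>k > s\<close> and \<open>G\<^sub>k\<^sub>+\<^sub>1 \<ge> r - s\<close> allows \<open>Y\<^sub>k\<close> and \<open>G\<^sub>k\<^sub>+\<^sub>1\<close> to be decoupled in \<open>E (Y\<^sub>k + G\<^sub>k\<^sub>+\<^sub>1 - r)\<^sup>+\<close>.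
  Backward induction on \<open>k\<close> then gives \<open>E (G\<^sub>1 - r)\<^sup>+ \<le> (\<Prod>i. b\<^sub>i) exp (- l r) / l\<close> whenever
  \<open>E exp (l Y\<^sub>i) \<le> b\<^sub>i\<close> and \<open>b\<^sub>i \<ge> 1\<close>, without any comparison with independent copies. Markov's
  inequality at \<open>r = u = \<alpha> x\<close> produces the factor \<open>1 / (1 - \<alpha>)\<close>, and the event that some
  \<open>X\<^sub>i\<close> exceeds \<open>y\<close> is controlled by the moment assumption. For \<open>u \<ge> K powr (1 / (2 - p))\<close> one takes
  \<open>y = u\<close>, \<open>l = u powr (p - 1)\<close>; otherwise \<open>y = K powr (1 / (2 - p))\<close>, \<open>l = u / K\<close>, the bound
  exceeding 1 when \<open>u\<^sup>2 / K < \<alpha>\<close>.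
\<close>

section \<open>Elementary exponential inequalities\<close>

text \<open>The factor \<open>exp (max 0 t)\<close> serves both signs. For positive \<open>t\<close>
  it dominates the Lagrange remainder of order two, and for \<open>t \<le> 0\<close> it is 1,
  leaving the quadratic Taylor bound.\<close>

lemma exp_le_second_order:
  fixes t :: real
  shows "exp t \<le> 1 + t + t\<^sup>2 / 2 * exp (max 0 t)"
proof (cases "t \<le> 0")
  case True
  define x where "x = - t"
  have x: "x \<ge> 0" using True by (simp add: x_def)
  have q: "1 - x + x\<^sup>2 / 2 > 0"
    using zero_le_power2[of "x - 1"] by (simp add: power2_eq_square algebra_simps)
  \<comment> \<open>The product equals \<open>1 + x^4 / 4\<close>, so the positive factor
    \<open>1 - x + x^2 / 2\<close> dominates \<open>exp (- x)\<close>.\<close>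
  have "1 \<le> (1 + x + x\<^sup>2 / 2) * (1 - x + x\<^sup>2 / 2)"
    using x by (simp add: algebra_simps power2_eq_square)
  also have "\<dots> \<le> exp x * (1 - x + x\<^sup>2 / 2)"
    using exp_lower_Taylor_quadratic[OF x] q by (intro mult_right_mono) auto
  finally have "exp t \<le> 1 - x + x\<^sup>2 / 2"
    by (simp add: x_def exp_minus divide_simps split: if_splits)
  then show ?thesis using True by (simp add: x_def)
next
  case False
  obtain s where s: "\<bar>s\<bar> \<le> \<bar>t\<bar>"
    and e: "exp t = (\<Sum>m<2. t ^ m / fact m) + exp s / fact 2 * t ^ 2"
    using Maclaurin_exp_le[of t 2] by blast
  have "exp s / 2 * t\<^sup>2 \<le> exp t / 2 * t\<^sup>2"
    using s False by (intro mult_right_mono) auto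
  with e False show ?thesis by (simp add: numeral_2_eq_2 algebra_simps)
qed

text \<open>The condition \<open>l \<le> y powr (p - 1)\<close> makes the exponential weight
  subexponential. For \<open>0 < z \<le> y\<close> and \<open>p < 1\<close> it gives
  \<open>l * z \<le> z powr (p - 1) * z = z powr p\<close>, so the weight of the second-order term
  is absorbed by \<open>exp (\<bar>x\<bar> powr p)\<close>.\<close>

lemma exp_min_le:
  fixes x y p l :: real
  assumes "0 < p" "p < 1" "0 < y" "0 \<le> l" "l \<le> y powr (p - 1)"
  shows "exp (l * min x y) \<le> 1 + l * x + l\<^sup>2 / 2 * (x\<^sup>2 * exp (\<bar>x\<bar> powr p))"
proof -
  define z where "z = min x y"
  have a: "max 0 (l * z) \<le> \<bar>x\<bar> powr p"
  proof (cases "z \<le> 0")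
    case True
    then have "l * z \<le> 0" using assms by (simp add: mult_nonneg_nonpos)
    then show ?thesis by simp
  next
    case False
    then have z: "0 < z" "z \<le> y" "z \<le> \<bar>x\<bar>" by (auto simp: z_def)
    have "l * z \<le> y powr (p - 1) * z" using assms z by (intro mult_right_mono) auto
    also have "\<dots> \<le> z powr (p - 1) * z"
      using assms z by (intro mult_right_mono powr_mono2') auto
    also have "\<dots> = z powr p" using z by (simp add: powr_diff)
    also have "\<dots> \<le> \<bar>x\<bar> powr p" using assms z by (intro powr_mono2) auto
    finally show ?thesis by simp
  qed
  have b: "z\<^sup>2 \<le> x\<^sup>2" using assms by (auto simp: z_def min_def)
  have "exp (l * z) \<le> 1 + l * z + (l * z)\<^sup>2 / 2 * exp (max 0 (l * z))"
    by (rule exp_le_second_order)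
  also have "\<dots> = 1 + l * z + l\<^sup>2 / 2 * (z\<^sup>2 * exp (max 0 (l * z)))"
    by (simp add: power_mult_distrib)
  also have "\<dots> \<le> 1 + l * x + l\<^sup>2 / 2 * (x\<^sup>2 * exp (\<bar>x\<bar> powr p))"
    using a b assms by (intro add_mono mult_left_mono mult_mono) (auto simp: z_def)
  finally show ?thesis by (simp add: z_def)
qed

section \<open>The reflected partial sum\<close>

text \<open>This is the Lindley recursion run backwards: the value is the maximum over
  \<open>j \<le> m\<close> of \<open>x k + ... + x (k + j - 1)\<close>, the empty sum included.
  Splitting off the first term leaves a function of the later indices alone, as negative association
  requires.\<close>

fun reflected_sum :: "(nat \<Rightarrow> real) \<Rightarrow> nat \<Rightarrow> nat \<Rightarrow> real" where
  "reflected_sum x 0 k = 0"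
| "reflected_sum x (Suc m) k = max 0 (x k + reflected_sum x m (Suc k))"

lemma reflected_sum_nonneg: "0 \<le> reflected_sum x m k"
  by (cases m) auto

lemma sum_le_reflected_sum:
  "j \<le> m \<Longrightarrow> (\<Sum>i=k..<k+j. x i) \<le> reflected_sum x m k"
proof (induction m arbitrary: j k)
  case (Suc m)
  show ?case
  proof (cases j)
    case (Suc j')
    have "(\<Sum>i=k..<k+j. x i) = x k + (\<Sum>i=Suc k..<Suc k+j'. x i)"
      using Suc by (simp add: sum.atLeast_Suc_lessThan)
    with Suc.IH[of j' "Suc k"] Suc Suc.prems show ?thesis by (simp add: le_max_iff_disj)
  qed simp
qed simp

text \<open>This makes the reflected sum an admissible increasing function in the definition of
  negative association.\<close>

lemma reflected_sum_mono:
  "(\<And>i. i \<in> {k..<k+m} \<Longrightarrow> x i \<le> z i) \<Longrightarrow> reflected_sum x m k \<le> reflected_sum z m k"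
proof (induction m arbitrary: k)
  case (Suc m)
  have "reflected_sum x m (Suc k) \<le> reflected_sum z m (Suc k)"
    by (intro Suc.IH Suc.prems) auto
  moreover have "x k \<le> z k" by (intro Suc.prems) auto
  ultimately show ?case by (simp add: max_def)
qed simp

lemma reflected_sum_cong:
  assumes "\<And>i. i \<in> {k..<k+m} \<Longrightarrow> x i = z i"
  shows "reflected_sum x m k = reflected_sum z m k"
  by (intro order.antisym reflected_sum_mono) (simp_all add: assms)

lemma measurable_reflected_sum:
  assumes "\<And>i. i \<in> {k..<k+m} \<Longrightarrow> (\<lambda>\<omega>. Y \<omega> i) \<in> borel_measurable M"
  shows "(\<lambda>\<omega>. reflected_sum (Y \<omega>) m k) \<in> borel_measurable M"
  using assms
proof (induction m arbitrary: k)
  case (Suc m)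
  have "(\<lambda>\<omega>. reflected_sum (Y \<omega>) m (Suc k)) \<in> borel_measurable M"
    by (intro Suc.IH Suc.prems) auto
  moreover have "(\<lambda>\<omega>. Y \<omega> k) \<in> borel_measurable M" by (intro Suc.prems) auto
  ultimately show ?case by simp
qed simp

section \<open>Negative association of threshold events\<close>

text \<open>A negatively associated sequence supplies the property only for lengths from 2 on; the
  case of one variable is reached by restricting from length 2.\<close>

lemma negatively_associated_mono:
  assumes "negatively_associated M n X" "m \<le> n"
  shows "negatively_associated M m X"
proof -
  have sub: "A \<subseteq> {1..n}" if "A \<subseteq> {1..m}" for A
    using that assms(2) by fastforce
  show ?thesis
    unfolding negatively_associated_def
  proof (intro conjI ballI allI impI)
    fix i assume "i \<in> {1..m}"
    then show "X i \<in> borel_measurable M"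
      using assms by (auto simp: negatively_associated_def)
  next
    fix A1 A2 f1 f2
    assume *: "A1 \<subseteq> {1..m} \<and> A2 \<subseteq> {1..m} \<and> A1 \<inter> A2 = {} \<and>
      coordinatewise_increasing A1 f1 \<and> coordinatewise_increasing A2 f2 \<and>
      covariance_exists M (\<lambda>\<omega>. f1 (\<lambda>i\<in>A1. X i \<omega>)) (\<lambda>\<omega>. f2 (\<lambda>j\<in>A2. X j \<omega>))"
    then have "A1 \<subseteq> {1..n}" "A2 \<subseteq> {1..n}" using sub by blast+
    with * show "covariance M (\<lambda>\<omega>. f1 (\<lambda>i\<in>A1. X i \<omega>)) (\<lambda>\<omega>. f2 (\<lambda>j\<in>A2. X j \<omega>)) \<le> 0"
      using assms(1) unfolding negatively_associated_def by blast
  qed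
qed

text \<open>The indicator of an upper threshold set of an increasing function is again increasing.
  It is bounded, so the covariance exists, and the covariance of two indicators is
  \<open>prob (U \<inter> V) - prob U * prob V\<close>.\<close>

lemma negatively_associated_prob_le:
  assumes "prob_space M" "negatively_associated M n X"
    and A: "A1 \<subseteq> {1..n}" "A2 \<subseteq> {1..n}" "A1 \<inter> A2 = {}"
    and inc: "coordinatewise_increasing A1 f1" "coordinatewise_increasing A2 f2"
    and m1: "(\<lambda>\<omega>. f1 (\<lambda>i\<in>A1. X i \<omega>)) \<in> borel_measurable M"
    and m2: "(\<lambda>\<omega>. f2 (\<lambda>i\<in>A2. X i \<omega>)) \<in> borel_measurable M"
  shows "emeasure M {\<omega>\<in>space M. f1 (\<lambda>i\<in>A1. X i \<omega>) > s \<and> f2 (\<lambda>i\<in>A2. X i \<omega>) \<ge> t}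
    \<le> emeasure M {\<omega>\<in>space M. f1 (\<lambda>i\<in>A1. X i \<omega>) > s}
      * emeasure M {\<omega>\<in>space M. f2 (\<lambda>i\<in>A2. X i \<omega>) \<ge> t}"
proof -
  interpret prob_space M by fact
  define U where "U = {\<omega>\<in>space M. f1 (\<lambda>i\<in>A1. X i \<omega>) > s}"
  define V where "V = {\<omega>\<in>space M. f2 (\<lambda>i\<in>A2. X i \<omega>) \<ge> t}"
  have [measurable]: "U \<in> sets M" "V \<in> sets M"
    using m1 m2 by (auto simp: U_def V_def)
  define h1 where "h1 = (\<lambda>x. if f1 x > s then 1 else 0 :: real)"
  define h2 where "h2 = (\<lambda>x. if f2 x \<ge> t then 1 else 0 :: real)"
  have h1: "h1 (\<lambda>i\<in>A1. X i \<omega>) = indicator U \<omega>" if "\<omega> \<in> space M" for \<omega>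
    using that by (auto simp: h1_def U_def indicator_def)
  have h2: "h2 (\<lambda>i\<in>A2. X i \<omega>) = indicator V \<omega>" if "\<omega> \<in> space M" for \<omega>
    using that by (auto simp: h2_def V_def indicator_def)
  have h12: "h1 (\<lambda>i\<in>A1. X i \<omega>) * h2 (\<lambda>i\<in>A2. X i \<omega>) = indicator (U \<inter> V) \<omega>"
    if "\<omega> \<in> space M" for \<omega>
    using h1[OF that] h2[OF that] by (simp add: indicator_inter_arith)
  have c1: "coordinatewise_increasing A1 h1"
    unfolding coordinatewise_increasing_def
  proof (intro ballI monoI)
    fix u :: "nat \<Rightarrow> real" and i and a b :: real assume "u \<in> A1 \<rightarrow>\<^sub>E UNIV" "i \<in> A1" "a \<le> b"
    then have "f1 (u(i := a)) \<le> f1 (u(i := b))"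
      using inc(1) unfolding coordinatewise_increasing_def mono_def by blast
    then show "h1 (u(i := a)) \<le> h1 (u(i := b))" by (simp add: h1_def)
  qed
  have c2: "coordinatewise_increasing A2 h2"
    unfolding coordinatewise_increasing_def
  proof (intro ballI monoI)
    fix u :: "nat \<Rightarrow> real" and i and a b :: real assume "u \<in> A2 \<rightarrow>\<^sub>E UNIV" "i \<in> A2" "a \<le> b"
    then have "f2 (u(i := a)) \<le> f2 (u(i := b))"
      using inc(2) unfolding coordinatewise_increasing_def mono_def by blast
    then show "h2 (u(i := a)) \<le> h2 (u(i := b))" by (simp add: h2_def)
  qed
  have ind: "integrable M (indicat_real W)" if "W \<in> sets M" for W
    using that by (intro integrable_real_indicator) (auto simp: less_top[symmetric])
  have i1: "integrable M (\<lambda>\<omega>. h1 (\<lambda>i\<in>A1. X i \<omega>))"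
    by (subst Bochner_Integration.integrable_cong[OF refl h1]) (auto intro!: ind)
  have i2: "integrable M (\<lambda>\<omega>. h2 (\<lambda>i\<in>A2. X i \<omega>))"
    by (subst Bochner_Integration.integrable_cong[OF refl h2]) (auto intro!: ind)
  have i12: "integrable M (\<lambda>\<omega>. h1 (\<lambda>i\<in>A1. X i \<omega>) * h2 (\<lambda>i\<in>A2. X i \<omega>))"
    by (subst Bochner_Integration.integrable_cong[OF refl h12]) (auto intro!: ind)
  have I1: "(LINT \<omega>|M. h1 (\<lambda>i\<in>A1. X i \<omega>)) = prob U"
    by (subst Bochner_Integration.integral_cong[OF refl h1]) auto
  have I2: "(LINT \<omega>|M. h2 (\<lambda>i\<in>A2. X i \<omega>)) = prob V"
    by (subst Bochner_Integration.integral_cong[OF refl h2]) auto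
  have I12: "(LINT \<omega>|M. h1 (\<lambda>i\<in>A1. X i \<omega>) * h2 (\<lambda>i\<in>A2. X i \<omega>)) = prob (U \<inter> V)"
    by (subst Bochner_Integration.integral_cong[OF refl h12]) auto
  have "covariance M (\<lambda>\<omega>. h1 (\<lambda>i\<in>A1. X i \<omega>)) (\<lambda>\<omega>. h2 (\<lambda>i\<in>A2. X i \<omega>)) \<le> 0"
    using assms(2) A c1 c2 i1 i2 i12
    unfolding negatively_associated_def covariance_exists_def by blast
  also have "covariance M (\<lambda>\<omega>. h1 (\<lambda>i\<in>A1. X i \<omega>)) (\<lambda>\<omega>. h2 (\<lambda>i\<in>A2. X i \<omega>))
      = prob (U \<inter> V) - prob U * prob V"
    unfolding covariance_def I1 I2 using i1 i2 i12 I1 I2 I12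
    by (simp add: algebra_simps prob_space)
  finally have "prob (U \<inter> V) \<le> prob U * prob V" by simp
  then have "emeasure M (U \<inter> V) \<le> emeasure M U * emeasure M V"
    by (simp add: emeasure_eq_measure flip: ennreal_mult)
  also have "U \<inter> V = {\<omega>\<in>space M. f1 (\<lambda>i\<in>A1. X i \<omega>) > s \<and> f2 (\<lambda>i\<in>A2. X i \<omega>) \<ge> t}"
    by (auto simp: U_def V_def)
  finally show ?thesis by (simp add: U_def V_def)
qed

section \<open>Decoupling by layers\<close>

text \<open>Since \<open>ennreal\<close> sends negative reals to 0, the left side is a positive
  part. The half-open interval explains the mixture of strict and weak thresholds in the event
  inequality.\<close>

lemma ennreal_add_diff_eq_layers:
  fixes a b r :: real
  shows "ennreal (a + b - r) = (\<integral>\<^sup>+s. indicator {..<a} s * indicator {r - b..} s \<partial>lborel)"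
proof -
  have "(\<integral>\<^sup>+s. indicator {..<a} s * indicator {r - b..} s \<partial>lborel)
      = (\<integral>\<^sup>+s. indicator {r - b..<a} s \<partial>lborel)"
    by (intro nn_integral_cong) (auto simp: indicator_def)
  also have "\<dots> = ennreal (a + b - r)"
  proof (cases "r - b \<le> a")
    case True
    then show ?thesis by (simp add: algebra_simps)
  next
    case False
    then show ?thesis by (simp add: ennreal_neg)
  qed
  finally show ?thesis ..
qed

lemma emeasure_Collect_eq_nn_integral:
  assumes [measurable]: "Measurable.pred M P"
  shows "emeasure M {\<omega>\<in>space M. P \<omega>} = (\<integral>\<^sup>+\<omega>. of_bool (P \<omega>) \<partial>M)"
proof -
  have "emeasure M {\<omega>\<in>space M. P \<omega>} = (\<integral>\<^sup>+\<omega>. indicator {\<omega>\<in>space M. P \<omega>} \<omega> \<partial>M)"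
    by (rule nn_integral_indicator[symmetric]) measurable
  also have "\<dots> = (\<integral>\<^sup>+\<omega>. of_bool (P \<omega>) \<partial>M)"
    by (rule nn_integral_cong) (simp add: indicator_def)
  finally show ?thesis .
qed

text \<open>By Tonelli the excess is an integral over \<open>s\<close> of probabilities of joint
  threshold events. The hypothesis bounds each by a product, which is an iterated integral in
  separate variables \<open>\<omega>\<close> and \<open>\<omega>'\<close>; Tonelli then reassembles
  the excess.\<close>

lemma nn_integral_excess_le_decoupled:
  fixes U V :: "'a \<Rightarrow> real"
  assumes "prob_space M"
    and [measurable]: "U \<in> borel_measurable M" "V \<in> borel_measurable M"
    and neg: "\<And>s t. emeasure M {\<omega>\<in>space M. U \<omega> > s \<and> V \<omega> \<ge> t}
      \<le> emeasure M {\<omega>\<in>space M. U \<omega> > s} * emeasure M {\<omega>\<in>space M. V \<omega> \<ge> t}"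
  shows "(\<integral>\<^sup>+\<omega>. ennreal (U \<omega> + V \<omega> - r) \<partial>M)
    \<le> (\<integral>\<^sup>+\<omega>. \<integral>\<^sup>+\<omega>'. ennreal (U \<omega> + V \<omega>' - r) \<partial>M \<partial>M)"
proof -
  interpret prob_space M by fact
  interpret L: pair_sigma_finite M lborel ..
  have [measurable]: "Measurable.pred (M \<Otimes>\<^sub>M lborel) (\<lambda>q. snd q < U (fst q))"
    "Measurable.pred (M \<Otimes>\<^sub>M lborel) (\<lambda>q. r - V (fst q) \<le> snd q)"
    by measurable
  have "(\<integral>\<^sup>+\<omega>. ennreal (U \<omega> + V \<omega> - r) \<partial>M)
      = (\<integral>\<^sup>+s. \<integral>\<^sup>+\<omega>. indicator {..<U \<omega>} s * indicator {r - V \<omega>..} s \<partial>M \<partial>lborel)"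
    unfolding ennreal_add_diff_eq_layers
    by (rule L.Fubini'[symmetric]) (simp add: indicator_def split_beta)
  also have "\<dots> = (\<integral>\<^sup>+s. emeasure M {\<omega>\<in>space M. U \<omega> > s \<and> V \<omega> \<ge> r - s} \<partial>lborel)"
    by (subst emeasure_Collect_eq_nn_integral)
       (auto intro!: nn_integral_cong simp: indicator_def)
  also have "\<dots> \<le> (\<integral>\<^sup>+s. emeasure M {\<omega>\<in>space M. U \<omega> > s}
      * emeasure M {\<omega>\<in>space M. V \<omega> \<ge> r - s} \<partial>lborel)"
    by (intro nn_integral_mono neg)
  also have "\<dots> = (\<integral>\<^sup>+s. \<integral>\<^sup>+\<omega>. \<integral>\<^sup>+\<omega>'. indicator {..<U \<omega>} s * indicator {r - V \<omega>'..} s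
      \<partial>M \<partial>M \<partial>lborel)"
  proof (intro nn_integral_cong)
    fix s
    have "emeasure M {\<omega>\<in>space M. U \<omega> > s} = (\<integral>\<^sup>+\<omega>. indicator {..<U \<omega>} s \<partial>M)"
      by (subst emeasure_Collect_eq_nn_integral)
         (auto intro!: nn_integral_cong simp: indicator_def algebra_simps)
    moreover have "emeasure M {\<omega>\<in>space M. V \<omega> \<ge> r - s} = (\<integral>\<^sup>+\<omega>. indicator {r - V \<omega>..} s \<partial>M)"
      by (subst emeasure_Collect_eq_nn_integral)
         (auto intro!: nn_integral_cong simp: indicator_def algebra_simps)
    ultimately show "emeasure M {\<omega>\<in>space M. U \<omega> > s} * emeasure M {\<omega>\<in>space M. V \<omega> \<ge> r - s}
      = (\<integral>\<^sup>+\<omega>. \<integral>\<^sup>+\<omega>'. indicator {..<U \<omega>} s * indicator {r - V \<omega>'..} s \<partial>M \<partial>M)"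
      by (simp add: nn_integral_cmult nn_integral_multc indicator_def)
  qed
  also have "\<dots> = (\<integral>\<^sup>+\<omega>. \<integral>\<^sup>+s. \<integral>\<^sup>+\<omega>'. indicator {..<U \<omega>} s * indicator {r - V \<omega>'..} s
      \<partial>M \<partial>lborel \<partial>M)"
    by (rule L.Fubini') (simp add: indicator_def split_beta)
  also have "\<dots> = (\<integral>\<^sup>+\<omega>. \<integral>\<^sup>+\<omega>'. \<integral>\<^sup>+s. indicator {..<U \<omega>} s * indicator {r - V \<omega>'..} s
      \<partial>lborel \<partial>M \<partial>M)"
    by (intro nn_integral_cong L.Fubini') (simp add: indicator_def split_beta)
  finally show ?thesis unfolding ennreal_add_diff_eq_layers .
qed


section \<open>Excess bound and maximal inequality\<close>

text \<open>The level \<open>r\<close> must be arbitrary, even negative, because the induction step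
  invokes the hypothesis at the shifted level \<open>r - Y \<omega> k\<close>.\<close>

lemma nn_integral_excess_reflected_sum_le:
  fixes b :: "nat \<Rightarrow> real"
  assumes "prob_space M" "negatively_associated M n X"
    and l: "0 < l"
    and mgf: "\<And>i. i \<in> {1..n} \<Longrightarrow> (\<integral>\<^sup>+\<omega>. ennreal (exp (l * min (X i \<omega>) y)) \<partial>M) \<le> ennreal (b i)"
    and b: "\<And>i. i \<in> {1..n} \<Longrightarrow> 1 \<le> b i"
    and k: "1 \<le> k" "k + m \<le> Suc n"
  shows "(\<integral>\<^sup>+\<omega>. ennreal (reflected_sum (\<lambda>i. min (X i \<omega>) y) m k - r) \<partial>M)
    \<le> ennreal ((\<Prod>i=k..<k+m. b i) * exp (- l * r) / l)"
  using k
proof (induction m arbitrary: k r)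
  interpret prob_space M by fact
  case 0
  \<comment> \<open>With no terms the reflected sum is 0, so only the positive part of
    \<open>- r\<close> has to be bounded.\<close>
  have "- (l * r) \<le> exp (- (l * r))" using exp_ge_add_one_self[of "- (l * r)"] by linarith
  then have "- r \<le> exp (- (l * r)) / l" using l by (simp add: field_simps)
  then show ?case by (simp add: emeasure_space_1 ennreal_leI)
next
  interpret prob_space M by fact
  case (Suc m)
  define Y where "Y = (\<lambda>\<omega> i. min (X i \<omega>) y)"
  define G where "G = (\<lambda>\<omega>. reflected_sum (Y \<omega>) m (Suc k))"
  define C where "C = (\<Prod>i=Suc k..<Suc k+m. b i)"
  have kn: "k \<in> {1..n}" "{Suc k..<Suc k+m} \<subseteq> {1..n}" using Suc.prems by auto
  have prodC: "(\<Prod>i=k..<k + Suc m. b i) = b k * C"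
    by (simp add: C_def prod.atLeast_Suc_lessThan)
  have C1: "1 \<le> C" unfolding C_def using b kn(2) by (intro prod_ge_1) blast
  have measX: "X i \<in> borel_measurable M" if "i \<in> {1..n}" for i
    using assms(2) that by (simp add: negatively_associated_def)
  have mk [measurable]: "(\<lambda>\<omega>. Y \<omega> k) \<in> borel_measurable M"
    unfolding Y_def using measX[OF kn(1)] by measurable
  have mG [measurable]: "G \<in> borel_measurable M"
    unfolding G_def Y_def using measX kn(2)
    by (intro measurable_reflected_sum borel_measurable_min) auto
  have IH: "(\<integral>\<^sup>+\<omega>. ennreal (G \<omega> - s) \<partial>M) \<le> ennreal (C * exp (- l * s) / l)" for s
    using Suc.IH[of "Suc k" s] Suc.prems by (simp add: G_def Y_def C_def)
  have neg: "emeasure M {\<omega>\<in>space M. Y \<omega> k > s \<and> G \<omega> \<ge> t}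
      \<le> emeasure M {\<omega>\<in>space M. Y \<omega> k > s} * emeasure M {\<omega>\<in>space M. G \<omega> \<ge> t}" for s t
  proof -
    define A2 where "A2 = {Suc k..<Suc k+m}"
    define f1 where "f1 = (\<lambda>x::nat\<Rightarrow>real. min (x k) y)"
    define f2 where "f2 = (\<lambda>x::nat\<Rightarrow>real. reflected_sum (\<lambda>i. min (x i) y) m (Suc k))"
    have f1: "f1 (\<lambda>i\<in>{k}. X i \<omega>) = Y \<omega> k" for \<omega> by (simp add: f1_def Y_def)
    \<comment> \<open>The reflected sum reads only indices in \<open>A2\<close>, so the default
      value outside \<open>A2\<close> is never seen.\<close>
    have f2: "f2 (\<lambda>i\<in>A2. X i \<omega>) = G \<omega>" for \<omega>
      unfolding f2_def G_def Y_def by (intro reflected_sum_cong) (simp add: A2_def)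
    have "coordinatewise_increasing {k} f1"
      by (auto simp: coordinatewise_increasing_def f1_def mono_def)
    moreover have "coordinatewise_increasing A2 f2"
      unfolding coordinatewise_increasing_def f2_def
      by (intro ballI monoI reflected_sum_mono) auto
    moreover have "{k} \<subseteq> {1..n}" "A2 \<subseteq> {1..n}" "{k} \<inter> A2 = {}"
      using kn by (auto simp: A2_def)
    ultimately show ?thesis
      using negatively_associated_prob_le[OF assms(1,2), of "{k}" A2 f1 f2 s t] mk mG
      by (simp add: f1 f2)
  qed
  have main: "(\<integral>\<^sup>+\<omega>. ennreal (Y \<omega> k + G \<omega> - r) \<partial>M) \<le> ennreal (b k * C * exp (- l * r) / l)" for r
  proof -
    have "(\<integral>\<^sup>+\<omega>. ennreal (Y \<omega> k + G \<omega> - r) \<partial>M)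
        \<le> (\<integral>\<^sup>+\<omega>. \<integral>\<^sup>+\<omega>'. ennreal (Y \<omega> k + G \<omega>' - r) \<partial>M \<partial>M)"
      by (rule nn_integral_excess_le_decoupled[OF assms(1) mk mG neg])
    also have "\<dots> \<le> (\<integral>\<^sup>+\<omega>. ennreal (C * exp (- l * r) / l) * ennreal (exp (l * Y \<omega> k)) \<partial>M)"
    proof (intro nn_integral_mono)
      fix \<omega>
      \<comment> \<open>For fixed \<open>\<omega>\<close> the number \<open>Y \<omega> k\<close>
        merely shifts the level; the induction hypothesis turns this shift into the factor
        \<open>exp (l * Y \<omega> k)\<close>.\<close>
      have "(\<integral>\<^sup>+\<omega>'. ennreal (Y \<omega> k + G \<omega>' - r) \<partial>M) = (\<integral>\<^sup>+\<omega>'. ennreal (G \<omega>' - (r - Y \<omega> k)) \<partial>M)"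
        by (simp add: algebra_simps)
      also have "\<dots> \<le> ennreal (C * exp (- l * (r - Y \<omega> k)) / l)" by (rule IH)
      also have "C * exp (- l * (r - Y \<omega> k)) / l = (C * exp (- l * r) / l) * exp (l * Y \<omega> k)"
        by (simp add: algebra_simps flip: exp_add)
      also have "ennreal \<dots> = ennreal (C * exp (- l * r) / l) * ennreal (exp (l * Y \<omega> k))"
        using C1 l by (intro ennreal_mult) auto
      finally show "(\<integral>\<^sup>+\<omega>'. ennreal (Y \<omega> k + G \<omega>' - r) \<partial>M)
        \<le> ennreal (C * exp (- l * r) / l) * ennreal (exp (l * Y \<omega> k))" .
    qed
    also have "\<dots> = ennreal (C * exp (- l * r) / l) * (\<integral>\<^sup>+\<omega>. ennreal (exp (l * Y \<omega> k)) \<partial>M)"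
      by (rule nn_integral_cmult) measurable
    also have "\<dots> \<le> ennreal (C * exp (- l * r) / l) * ennreal (b k)"
      using mgf[OF kn(1)] by (intro mult_left_mono) (auto simp: Y_def)
    also have "\<dots> = ennreal (b k * C * exp (- l * r) / l)"
      using C1 l b[OF kn(1)] by (simp add: mult_ac flip: ennreal_mult)
    finally show ?thesis .
  qed
  \<comment> \<open>Reflection at 0 does not change the excess over a level
    \<open>r \<ge> 0\<close>. For \<open>r < 0\<close> the excess is the positive part plus
    \<open>- r\<close>; the bound at level 0 then suffices, by \<open>1 + t \<le> exp t\<close> and
    \<open>b k * C \<ge> 1\<close>.\<close>
  have step: "(\<integral>\<^sup>+\<omega>. ennreal (max 0 (Y \<omega> k + G \<omega>) - r) \<partial>M) \<le> ennreal (b k * C * exp (- l * r) / l)"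
  proof (cases "r \<ge> 0")
    case True
    then have "ennreal (max 0 (Y \<omega> k + G \<omega>) - r) = ennreal (Y \<omega> k + G \<omega> - r)" for \<omega>
      by (auto simp: max_def ennreal_neg)
    then show ?thesis using main[of r] by simp
  next
    case False
    have "(\<integral>\<^sup>+\<omega>. ennreal (max 0 (Y \<omega> k + G \<omega>) - r) \<partial>M)
        = (\<integral>\<^sup>+\<omega>. ennreal (Y \<omega> k + G \<omega> - 0) + ennreal (- r) \<partial>M)"
    proof (intro nn_integral_cong)
      fix \<omega>
      have "ennreal (max 0 (Y \<omega> k + G \<omega>) - r) = ennreal (max 0 (Y \<omega> k + G \<omega>)) + ennreal (- r)"
        using False by (subst ennreal_plus[symmetric]) auto
      moreover have "ennreal (Y \<omega> k + G \<omega> - 0) = ennreal (max 0 (Y \<omega> k + G \<omega>))"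
        by (auto simp: max_def ennreal_neg)
      ultimately show "ennreal (max 0 (Y \<omega> k + G \<omega>) - r) = ennreal (Y \<omega> k + G \<omega> - 0) + ennreal (- r)"
        by simp
    qed
    also have "\<dots> = (\<integral>\<^sup>+\<omega>. ennreal (Y \<omega> k + G \<omega> - 0) \<partial>M) + ennreal (- r)"
      by (subst nn_integral_add) (auto simp: emeasure_space_1)
    also have "\<dots> \<le> ennreal (b k * C * exp (- l * 0) / l) + ennreal (- r)"
      by (intro add_right_mono main)
    also have "\<dots> = ennreal (b k * C / l - r)"
      using False C1 l b[OF kn(1)] by (simp flip: ennreal_plus)
    also have "\<dots> \<le> ennreal (b k * C * exp (- l * r) / l)"
    proof (rule ennreal_leI)
      have bC: "1 \<le> b k * C" using b[OF kn(1)] C1 mult_mono[of 1 "b k" 1 C] by simp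
      have "b k * C + (- l * r) \<le> b k * C + b k * C * (- l * r)"
        using bC False l mult_right_mono[of 1 "b k * C" "- l * r"]
        by (simp add: mult_nonneg_nonpos)
      also have "\<dots> = b k * C * (1 + (- l * r))" by (simp add: algebra_simps)
      also have "\<dots> \<le> b k * C * exp (- l * r)"
        using bC by (intro mult_left_mono exp_ge_add_one_self) auto
      finally have "(b k * C + (- l * r)) / l \<le> b k * C * exp (- l * r) / l"
        using l by (intro divide_right_mono) auto
      then show "b k * C / l - r \<le> b k * C * exp (- l * r) / l"
        using l by (simp add: diff_divide_distrib)
    qed
    finally show ?thesis .
  qed
  then show ?case unfolding prodC by (simp add: G_def Y_def)
qed

text \<open>If no \<open>X i\<close> exceeds \<open>y\<close>, truncation changes nothing and the
  maximal partial sum is at most \<open>G\<close>. What remains is the event that \<open>G\<close>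
  reaches \<open>x\<close>.\<close>

lemma (in prob_space) negatively_associated_max_prob_le:
  fixes b :: "nat \<Rightarrow> real"
  assumes NA: "negatively_associated M N X" and n: "1 \<le> n" "n \<le> N"
    and l: "0 < l" and ux: "u < x"
    and mgf: "\<And>i. i \<in> {1..n} \<Longrightarrow> (\<integral>\<^sup>+\<omega>. ennreal (exp (l * min (X i \<omega>) y)) \<partial>M) \<le> ennreal (b i)"
    and b: "\<And>i. i \<in> {1..n} \<Longrightarrow> 1 \<le> b i"
  shows "prob {\<omega>\<in>space M. (MAX k\<in>{1..n}. \<Sum>i=1..k. X i \<omega>) \<ge> x}
    \<le> (\<Sum>i=1..n. prob {\<omega>\<in>space M. X i \<omega> > y}) + (\<Prod>i=1..n. b i) * exp (- l * u) / (l * (x - u))"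
proof -
  have NAn: "negatively_associated M n X"
    using NA n(2) by (rule negatively_associated_mono)
  have measX: "X i \<in> borel_measurable M" if "i \<in> {1..n}" for i
    using NAn that by (simp add: negatively_associated_def)
  define G where "G = (\<lambda>\<omega>. reflected_sum (\<lambda>i. min (X i \<omega>) y) n 1)"
  have mG [measurable]: "G \<in> borel_measurable M"
    unfolding G_def using measX
    by (intro measurable_reflected_sum borel_measurable_min) auto
  define E where "E = {\<omega>\<in>space M. (MAX k\<in>{1..n}. \<Sum>i=1..k. X i \<omega>) \<ge> x}"
  define B where "B = (\<lambda>i. {\<omega>\<in>space M. X i \<omega> > y})"
  define H where "H = {\<omega>\<in>space M. G \<omega> \<ge> x}"
  have B: "B i \<in> events" if "i \<in> {1..n}" for i
    unfolding B_def using measX[OF that] by measurable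
  have H [measurable]: "H \<in> events" unfolding H_def by measurable
  have sub: "E \<subseteq> (\<Union>i\<in>{1..n}. B i) \<union> H"
  proof
    fix \<omega> assume w: "\<omega> \<in> E"
    show "\<omega> \<in> (\<Union>i\<in>{1..n}. B i) \<union> H"
    proof (cases "\<omega> \<in> (\<Union>i\<in>{1..n}. B i)")
      case False
      then have t: "min (X i \<omega>) y = X i \<omega>" if "i \<in> {1..n}" for i
        using w that by (force simp: E_def B_def min_def)
      have "(MAX k\<in>{1..n}. \<Sum>i=1..k. X i \<omega>) \<in> (\<lambda>k. \<Sum>i=1..k. X i \<omega>) ` {1..n}"
        using n by (intro Max_in) auto
      then obtain k where k: "k \<in> {1..n}" "x \<le> (\<Sum>i=1..k. X i \<omega>)"
        using w by (auto simp: E_def)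
      note k(2)
      also have "(\<Sum>i=1..k. X i \<omega>) = (\<Sum>i=1..<1+k. min (X i \<omega>) y)"
        using k t by (intro sum.cong) auto
      also have "\<dots> \<le> G \<omega>"
        unfolding G_def using k by (intro sum_le_reflected_sum) auto
      finally show ?thesis using w by (simp add: H_def E_def)
    qed simp
  qed
  \<comment> \<open>On \<open>H\<close> the excess of \<open>G\<close> over \<open>u\<close> is at
    least \<open>x - u\<close>, so Markov's inequality applies to the excess.\<close>
  have "emeasure M H \<le> emeasure M {\<omega>\<in>space M. 1 \<le> ennreal (1 / (x - u)) * ennreal (G \<omega> - u)}"
  proof (rule emeasure_mono)
    show "H \<subseteq> {\<omega>\<in>space M. 1 \<le> ennreal (1 / (x - u)) * ennreal (G \<omega> - u)}"
    proof
      fix \<omega> assume "\<omega> \<in> H"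
      then have "\<omega> \<in> space M" "x - u \<le> G \<omega> - u" by (auto simp: H_def)
      moreover from this have "1 \<le> 1 / (x - u) * (G \<omega> - u)" using ux by (simp add: field_simps)
      ultimately show "\<omega> \<in> {\<omega>\<in>space M. 1 \<le> ennreal (1 / (x - u)) * ennreal (G \<omega> - u)}"
        using ux by (simp flip: ennreal_mult ennreal_1 add: ennreal_leI del: ennreal_1)
    qed
  qed measurable
  also have "\<dots> \<le> ennreal (1 / (x - u)) * (\<integral>\<^sup>+\<omega>. ennreal (G \<omega> - u) * indicator (space M) \<omega> \<partial>M)"
    by (rule nn_integral_Markov_inequality) auto
  also have "(\<integral>\<^sup>+\<omega>. ennreal (G \<omega> - u) * indicator (space M) \<omega> \<partial>M) = (\<integral>\<^sup>+\<omega>. ennreal (G \<omega> - u) \<partial>M)"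
    by (intro nn_integral_cong) auto
  also have "\<dots> \<le> ennreal ((\<Prod>i=1..<1+n. b i) * exp (- l * u) / l)"
    unfolding G_def using nn_integral_excess_reflected_sum_le[OF prob_space_axioms NAn l mgf b, of 1 n u]
    by simp
  finally have eH: "emeasure M H \<le> ennreal (1 / (x - u)) * ennreal ((\<Prod>i=1..<1+n. b i) * exp (- l * u) / l)"
    by (simp add: mult_left_mono)
  have n1: "{1..<1+n} = {1..n}" by auto
  have P1: "(\<Prod>i=1..n. b i) \<ge> 1" using b by (intro prod_ge_1) auto
  note eH[unfolded n1]
  also have "ennreal (1 / (x - u)) * ennreal ((\<Prod>i=1..n. b i) * exp (- l * u) / l)
      = ennreal ((\<Prod>i=1..n. b i) * exp (- l * u) / (l * (x - u)))"
    using l ux P1 by (subst ennreal_mult[symmetric]) (auto simp: mult_ac)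
  finally have pH: "prob H \<le> (\<Prod>i=1..n. b i) * exp (- l * u) / (l * (x - u))"
    using l ux P1 by (simp add: emeasure_eq_measure)
  have "prob E \<le> prob ((\<Union>i\<in>{1..n}. B i) \<union> H)"
    using sub B by (intro finite_measure_mono) auto
  also have "\<dots> \<le> prob (\<Union>i\<in>{1..n}. B i) + prob H"
    using B by (intro measure_Un_le) auto
  also have "prob (\<Union>i\<in>{1..n}. B i) \<le> (\<Sum>i=1..n. prob (B i))"
    using B by (intro measure_UNION_le) auto
  finally show ?thesis using pH by (simp add: E_def B_def)
qed


section \<open>Consequences of the moment assumption\<close>

text \<open>Integrating \<open>exp_min_le\<close> removes the linear term because the mean is zero.
  Passing from \<open>1 + t\<close> to \<open>exp t\<close> lets the later product over
  \<open>i\<close> become the exponential of a sum.\<close>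

lemma (in prob_space) truncated_mgf_le:
  fixes X :: "'a \<Rightarrow> real"
  assumes X: "integrable M X" "expectation X = 0"
    and W: "integrable M (\<lambda>\<omega>. (X \<omega>)\<^sup>2 * exp (\<bar>X \<omega>\<bar> powr p))"
    and "0 < p" "p < 1" "0 < y" "0 \<le> l" "l \<le> y powr (p - 1)"
  shows "(\<integral>\<^sup>+\<omega>. ennreal (exp (l * min (X \<omega>) y)) \<partial>M)
    \<le> ennreal (exp (l\<^sup>2 / 2 * expectation (\<lambda>\<omega>. (X \<omega>)\<^sup>2 * exp (\<bar>X \<omega>\<bar> powr p))))"
proof -
  let ?W = "\<lambda>\<omega>. (X \<omega>)\<^sup>2 * exp (\<bar>X \<omega>\<bar> powr p)"
  have le: "exp (l * min (X \<omega>) y) \<le> 1 + l * X \<omega> + l\<^sup>2 / 2 * ?W \<omega>" for \<omega>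
    using assms by (intro exp_min_le) auto
  have "(\<integral>\<^sup>+\<omega>. ennreal (exp (l * min (X \<omega>) y)) \<partial>M)
      \<le> (\<integral>\<^sup>+\<omega>. ennreal (1 + l * X \<omega> + l\<^sup>2 / 2 * ?W \<omega>) \<partial>M)"
    by (intro nn_integral_mono ennreal_leI le)
  also have "\<dots> = ennreal (expectation (\<lambda>\<omega>. 1 + l * X \<omega> + l\<^sup>2 / 2 * ?W \<omega>))"
  proof (rule nn_integral_eq_integral)
    show "integrable M (\<lambda>\<omega>. 1 + l * X \<omega> + l\<^sup>2 / 2 * ?W \<omega>)"
      using X W by (intro Bochner_Integration.integrable_add integrable_mult_right) auto
    show "AE \<omega> in M. 0 \<le> 1 + l * X \<omega> + l\<^sup>2 / 2 * ?W \<omega>"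
      using le by (intro always_eventually allI order.trans[OF exp_ge_zero])
  qed
  also have "expectation (\<lambda>\<omega>. 1 + l * X \<omega> + l\<^sup>2 / 2 * ?W \<omega>) = 1 + l\<^sup>2 / 2 * expectation ?W"
    using X W by (simp add: prob_space)
  also have "\<dots> \<le> exp (l\<^sup>2 / 2 * expectation ?W)" by (rule exp_ge_add_one_self)
  finally show ?thesis by (simp add: ennreal_leI)
qed

text \<open>Markov's inequality for the weight \<open>t^2 * exp (t powr p)\<close>, which increases
  on \<open>t \<ge> 0\<close>.\<close>

lemma (in prob_space) tail_prob_le_exp_moment:
  fixes X :: "'a \<Rightarrow> real"
  assumes W: "integrable M (\<lambda>\<omega>. (X \<omega>)\<^sup>2 * exp (\<bar>X \<omega>\<bar> powr p))"
    and "0 < p" "0 < y"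
  shows "prob {\<omega>\<in>space M. X \<omega> > y}
    \<le> expectation (\<lambda>\<omega>. (X \<omega>)\<^sup>2 * exp (\<bar>X \<omega>\<bar> powr p)) / (y\<^sup>2 * exp (y powr p))"
proof -
  let ?W = "\<lambda>\<omega>. (X \<omega>)\<^sup>2 * exp (\<bar>X \<omega>\<bar> powr p)"
  have c: "0 < y\<^sup>2 * exp (y powr p)" using assms by simp
  have meas: "?W \<in> borel_measurable M" using W by simp
  have "prob {\<omega>\<in>space M. X \<omega> > y} \<le> prob {\<omega>\<in>space M. ?W \<omega> \<ge> y\<^sup>2 * exp (y powr p)}"
  proof (rule finite_measure_mono)
    show "{\<omega>\<in>space M. X \<omega> > y} \<subseteq> {\<omega>\<in>space M. ?W \<omega> \<ge> y\<^sup>2 * exp (y powr p)}"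
      using assms by (auto intro!: mult_mono power_mono powr_mono2)
    show "{\<omega>\<in>space M. ?W \<omega> \<ge> y\<^sup>2 * exp (y powr p)} \<in> events" using meas by simp
  qed
  also have "\<dots> \<le> expectation ?W / (y\<^sup>2 * exp (y powr p))"
    using W c by (intro integral_Markov_inequality_measure[where A = "{}"]) auto
  finally show ?thesis .
qed

lemma (in prob_space) negatively_associated_max_prob_le_exp:
  assumes NA: "negatively_associated_seq M X"
    and int: "\<And>i. i \<ge> 1 \<Longrightarrow> integrable M (X i)"
    and mean: "\<And>i. i \<ge> 1 \<Longrightarrow> expectation (X i) = 0"
    and n: "n \<ge> 1" and p: "0 < p" "p < 1" and K: "0 \<le> K"
    and mom: "(\<Sum>i=1..n. \<integral>\<^sup>+\<omega>. ennreal ((X i \<omega>)\<^sup>2 * exp (\<bar>X i \<omega>\<bar> powr p)) \<partial>M) \<le> ennreal K"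
    and y: "0 < y" and l: "0 < l" "l \<le> y powr (p - 1)" and ux: "u < x"
  shows "prob {\<omega>\<in>space M. (MAX k\<in>{1..n}. \<Sum>i=1..k. X i \<omega>) \<ge> x}
    \<le> K / (y\<^sup>2 * exp (y powr p)) + exp (l\<^sup>2 * K / 2 - l * u) / (l * (x - u))"
proof -
  let ?W = "\<lambda>i \<omega>. (X i \<omega>)\<^sup>2 * exp (\<bar>X i \<omega>\<bar> powr p)"
  define w where "w = (\<lambda>i. expectation (?W i))"
  \<comment> \<open>The moment sum is taken in the extended nonnegative reals, so its finite bound
    forces each summand to be finite.\<close>
  have W: "integrable M (?W i)" if "i \<in> {1..n}" for i
  proof (rule integrableI_nonneg)
    show "?W i \<in> borel_measurable M" using int[of i] that by auto
    have "(\<integral>\<^sup>+\<omega>. ennreal (?W i \<omega>) \<partial>M) \<le> (\<Sum>i=1..n. \<integral>\<^sup>+\<omega>. ennreal (?W i \<omega>) \<partial>M)"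
      using that by (intro member_le_sum) auto
    also have "\<dots> < \<infinity>" using mom by (rule order.strict_trans1) simp
    finally show "(\<integral>\<^sup>+\<omega>. ennreal (?W i \<omega>) \<partial>M) < \<infinity>" .
  qed auto
  have w0: "0 \<le> w i" for i by (simp add: w_def)
  have "(\<Sum>i=1..n. \<integral>\<^sup>+\<omega>. ennreal (?W i \<omega>) \<partial>M) = (\<Sum>i=1..n. ennreal (w i))"
    using W by (intro sum.cong refl) (simp add: w_def nn_integral_eq_integral)
  also have "\<dots> = ennreal (\<Sum>i=1..n. w i)" using w0 by (intro sum_ennreal) auto
  finally have wK: "(\<Sum>i=1..n. w i) \<le> K" using mom K by simp
  have "negatively_associated M (max 2 n) X"
    using NA by (simp add: negatively_associated_seq_def)
  then have "prob {\<omega>\<in>space M. (MAX k\<in>{1..n}. \<Sum>i=1..k. X i \<omega>) \<ge> x}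
    \<le> (\<Sum>i=1..n. prob {\<omega>\<in>space M. X i \<omega> > y})
      + (\<Prod>i=1..n. exp (l\<^sup>2 / 2 * w i)) * exp (- l * u) / (l * (x - u))"
  proof (rule negatively_associated_max_prob_le)
    fix i assume i: "i \<in> {1..n}"
    show "(\<integral>\<^sup>+\<omega>. ennreal (exp (l * min (X i \<omega>) y)) \<partial>M) \<le> ennreal (exp (l\<^sup>2 / 2 * w i))"
      unfolding w_def using i p y l by (intro truncated_mgf_le int mean W) auto
  qed (use n l ux w0 in auto)
  also have "\<dots> \<le> K / (y\<^sup>2 * exp (y powr p)) + exp (l\<^sup>2 * K / 2 - l * u) / (l * (x - u))"
  proof (rule add_mono)
    have "(\<Sum>i=1..n. prob {\<omega>\<in>space M. X i \<omega> > y}) \<le> (\<Sum>i=1..n. w i / (y\<^sup>2 * exp (y powr p)))"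
      unfolding w_def using p y by (intro sum_mono tail_prob_le_exp_moment W) auto
    also have "\<dots> = (\<Sum>i=1..n. w i) / (y\<^sup>2 * exp (y powr p))" by (simp add: sum_divide_distrib)
    also have "\<dots> \<le> K / (y\<^sup>2 * exp (y powr p))" using wK by (intro divide_right_mono) auto
    finally show "(\<Sum>i=1..n. prob {\<omega>\<in>space M. X i \<omega> > y}) \<le> K / (y\<^sup>2 * exp (y powr p))" .
    have "(\<Prod>i=1..n. exp (l\<^sup>2 / 2 * w i)) * exp (- l * u) = exp (l\<^sup>2 / 2 * (\<Sum>i=1..n. w i) - l * u)"
      by (simp add: sum_distrib_left flip: exp_sum exp_add)
    also have "\<dots> \<le> exp (l\<^sup>2 * K / 2 - l * u)"
      using mult_left_mono[OF wK, of "l\<^sup>2 / 2"] by simp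
    finally show "(\<Prod>i=1..n. exp (l\<^sup>2 / 2 * w i)) * exp (- l * u) / (l * (x - u))
      \<le> exp (l\<^sup>2 * K / 2 - l * u) / (l * (x - u))"
      using l ux by (intro divide_right_mono) auto
  qed
  finally show ?thesis .
qed

section \<open>Choice of truncation level and exponent\<close>

lemma (in prob_space) negatively_associated_max_prob_bounds:
  assumes NA: "negatively_associated_seq M X"
    and int: "\<And>i. i \<ge> 1 \<Longrightarrow> integrable M (X i)"
    and mean: "\<And>i. i \<ge> 1 \<Longrightarrow> expectation (X i) = 0"
    and n: "n \<ge> 1" and p: "0 < p" "p < 1" and K: "1 \<le> K"
    and mom: "(\<Sum>i=1..n. \<integral>\<^sup>+\<omega>. ennreal ((X i \<omega>)\<^sup>2 * exp (\<bar>X i \<omega>\<bar> powr p)) \<partial>M) \<le> ennreal K"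
    and a: "0 < a" "a < 1" and x: "0 < x"
  shows "a * x \<le> K powr (1 / (2 - p)) \<Longrightarrow>
      prob {\<omega>\<in>space M. (MAX k\<in>{1..n}. \<Sum>i=1..k. X i \<omega>) \<ge> x}
        \<le> 2 / (1 - a) * exp (- (a\<^sup>2 * x\<^sup>2 / (2 * K)))" (is "?small \<Longrightarrow> ?P \<le> ?B1")
    and "a * x \<ge> K powr (1 / (2 - p)) \<Longrightarrow>
      prob {\<omega>\<in>space M. (MAX k\<in>{1..n}. \<Sum>i=1..k. X i \<omega>) \<ge> x}
        \<le> 2 / (1 - a) * exp (- (a powr p * x powr p / 2))" (is "?large \<Longrightarrow> _ \<le> ?B2")
proof -
  define u where "u = a * x"
  define y0 where "y0 = K powr (1 / (2 - p))"
  have u: "0 < u" "u < x" using a x by (auto simp: u_def)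
  have y0: "1 \<le> y0" using K p by (simp add: y0_def ge_one_powr_ge_zero)
  have y0K: "y0 powr (2 - p) = K" using K p by (simp add: y0_def powr_powr)
  have c1: "1 \<le> 1 / (1 - a)" using a by simp
  note bound = negatively_associated_max_prob_le_exp[OF NA int mean n p _ mom _ _ _ u(2)]
  \<comment> \<open>From \<open>y \<ge> y0 \<ge> 1\<close> follows
    \<open>K \<le> y powr (2 - p) \<le> y^2\<close>, so the prefactor is at most 1. This term and
    the next each take half of the constant \<open>2 / (1 - a)\<close>.\<close>
  have tail: "K / (y\<^sup>2 * exp (y powr p)) \<le> 1 / (1 - a) * exp (- e / 2)"
    if "y0 \<le> y" "e \<le> y powr p" for y e
  proof -
    have y: "1 \<le> y" using that y0 by simp
    have "K \<le> y powr (2 - p)" unfolding y0K[symmetric] using that y0 p by (intro powr_mono2) auto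
    also have "\<dots> \<le> y powr 2" using y p by (intro powr_mono) auto
    finally have "K \<le> y\<^sup>2" using y by simp
    then have "K / (y\<^sup>2 * exp (y powr p)) \<le> y\<^sup>2 / (y\<^sup>2 * exp (y powr p))"
      using y by (intro divide_right_mono) auto
    also have "\<dots> = 1 * exp (- (y powr p))" using y by (simp add: exp_minus field_simps)
    also have "\<dots> \<le> 1 / (1 - a) * exp (- e / 2)"
    proof (rule mult_mono[OF c1])
      have "0 \<le> y powr p" by simp
      then have "- (y powr p) \<le> - e / 2" using that by linarith
      then show "exp (- (y powr p)) \<le> exp (- e / 2)" by simp
    qed (use a in auto)
    finally show ?thesis .
  qed
  \<comment> \<open>Since \<open>x - u = u * (1 - a) / a\<close>, the condition
    \<open>a \<le> l * u\<close> is exactly what gives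
    \<open>l * (x - u) \<ge> 1 - a\<close>.\<close>
  have main: "exp (l\<^sup>2 * K / 2 - l * u) / (l * (x - u)) \<le> 1 / (1 - a) * exp (- e / 2)"
    if "0 < l" "a \<le> l * u" "l\<^sup>2 * K / 2 - l * u \<le> - e / 2" for l e
  proof -
    have "a * (1 - a) \<le> l * u * (1 - a)" using that a by (intro mult_right_mono) auto
    also have "\<dots> = a * (l * (x - u))" by (simp add: u_def algebra_simps)
    finally have "1 - a \<le> l * (x - u)" using a by simp
    then have "exp (l\<^sup>2 * K / 2 - l * u) / (l * (x - u)) \<le> exp (- e / 2) / (1 - a)"
      using that a by (intro frac_le) auto
    then show ?thesis by simp
  qed
  show "?P \<le> ?B1" if small: ?small
  proof (cases "a \<le> u\<^sup>2 / K")
    case True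
    \<comment> \<open>The choice \<open>l = u / K\<close> minimises
      \<open>l^2 * K / 2 - l * u\<close>, with minimum \<open>- u^2 / (2 * K)\<close>. It is
      admissible at level \<open>y0\<close> because \<open>u \<le> y0\<close> and
      \<open>K = y0 powr (2 - p)\<close>.\<close>
    have "u / K \<le> y0 powr 1 / y0 powr (2 - p)"
      using small K y0 by (simp add: y0K divide_right_mono u_def flip: y0_def)
    also have "\<dots> = y0 powr (p - 1)" by (subst powr_diff[symmetric]) simp
    finally have l: "u / K \<le> y0 powr (p - 1)" .
    have "u\<^sup>2 / K \<le> y0\<^sup>2 / y0 powr (2 - p)"
      unfolding y0K using small u K by (intro divide_right_mono power_mono) (auto simp: u_def y0_def)
    also have "\<dots> = y0 powr 2 / y0 powr (2 - p)" using y0 by simp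
    also have "\<dots> = y0 powr p" by (simp flip: powr_diff)
    finally have e: "u\<^sup>2 / K \<le> y0 powr p" .
    have "?P \<le> K / (y0\<^sup>2 * exp (y0 powr p)) + exp ((u / K)\<^sup>2 * K / 2 - u / K * u) / (u / K * (x - u))"
      using K y0 u l by (intro bound) auto
    also have "\<dots> \<le> 1 / (1 - a) * exp (- (u\<^sup>2 / K) / 2) + 1 / (1 - a) * exp (- (u\<^sup>2 / K) / 2)"
    proof (rule add_mono[OF tail[OF order.refl e] main])
      show "(u / K)\<^sup>2 * K / 2 - u / K * u \<le> - (u\<^sup>2 / K) / 2"
        using K by (simp add: field_simps power2_eq_square)
    qed (use True u K in \<open>auto simp: power2_eq_square\<close>)
    also have "\<dots> = ?B1" by (simp add: u_def power_mult_distrib)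
    finally show ?thesis .
  next
    case False
    \<comment> \<open>The exponent is at least \<open>- 1 / 2\<close>, so the exponential is at
      least \<open>1 / 2\<close> and the claimed bound is at least 1.\<close>
    then have "u\<^sup>2 / K \<le> 1" using a by linarith
    then have "- (1 / 2) \<le> - (a\<^sup>2 * x\<^sup>2 / (2 * K))"
      using K by (simp add: u_def power_mult_distrib field_simps)
    then have "exp (- (1 / 2)) \<le> exp (- (a\<^sup>2 * x\<^sup>2 / (2 * K)))" by simp
    then have h: "1 / 2 \<le> exp (- (a\<^sup>2 * x\<^sup>2 / (2 * K)))"
      using exp_ge_add_one_self[of "- (1 / 2) :: real"] by linarith
    have "2 * (1 / 2) \<le> 2 / (1 - a) * exp (- (a\<^sup>2 * x\<^sup>2 / (2 * K)))"
      using h a by (intro mult_mono) (auto simp: field_simps)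
    then show ?thesis using prob_le_1 by (intro order.trans[OF prob_le_1]) simp
  qed
  show "?P \<le> ?B2" if large: ?large
  proof -
    have u0: "y0 \<le> u" using large by (simp add: u_def y0_def)
    then have u1: "1 \<le> u" using y0 by simp
    \<comment> \<open>This is the largest exponent allowed at truncation level \<open>u\<close>. It
      gives \<open>l * u = u powr p \<ge> 1\<close> and \<open>l^2 * K \<le> u powr p\<close>, hence
      total exponent at most \<open>- (u powr p) / 2\<close>.\<close>
    define l where "l = u powr (p - 1)"
    have l0: "0 < l" using u by (simp add: l_def)
    have lu: "l * u = u powr p" using u by (simp add: l_def powr_diff)
    have up: "1 \<le> u powr p" using u1 p by (simp add: ge_one_powr_ge_zero)
    have "l\<^sup>2 * K \<le> l\<^sup>2 * u powr (2 - p)"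
      unfolding y0K[symmetric] using u0 y0 p by (intro mult_left_mono powr_mono2) auto
    also have "\<dots> = u powr (p - 1) * u powr (p - 1) * u powr (2 - p)"
      by (simp add: l_def power2_eq_square)
    also have "\<dots> = u powr p" by (simp flip: powr_add)
    finally have lK: "l\<^sup>2 * K \<le> u powr p" .
    have "?P \<le> K / (u\<^sup>2 * exp (u powr p)) + exp (l\<^sup>2 * K / 2 - l * u) / (l * (x - u))"
      using K u l0 by (intro bound) (auto simp: l_def)
    also have "\<dots> \<le> 1 / (1 - a) * exp (- (u powr p) / 2) + 1 / (1 - a) * exp (- (u powr p) / 2)"
      using u0 l0 up a lK by (intro add_mono tail main) (auto simp: lu)
    also have "\<dots> = ?B2" using a x by (simp add: u_def powr_mult)
    finally show ?thesis .
  qed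
qed

section \<open>The unified bound and the final statement\<close>

text \<open>Dropping either summand of \<open>K + u powr (2 - p)\<close> from the denominator only
  enlarges the fraction; without \<open>K\<close> it becomes \<open>u powr p / 2\<close>.\<close>

lemma regime_exponents_ge:
  fixes K p u :: real
  assumes "0 < K" "0 < u"
  shows "u\<^sup>2 / (2 * (K + u powr (2 - p))) \<le> u\<^sup>2 / (2 * K)"
    and "u\<^sup>2 / (2 * (K + u powr (2 - p))) \<le> u powr p / 2"
proof -
  show "u\<^sup>2 / (2 * (K + u powr (2 - p))) \<le> u\<^sup>2 / (2 * K)"
    using assms by (intro divide_left_mono) (auto intro!: mult_pos_pos add_pos_nonneg)
  have "u\<^sup>2 / (2 * (K + u powr (2 - p))) \<le> u\<^sup>2 / (2 * u powr (2 - p))"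
    using assms by (intro divide_left_mono) (auto intro!: mult_pos_pos add_pos_nonneg)
  also have "\<dots> = (u powr 2 / u powr (2 - p)) / 2" using assms by simp
  also have "\<dots> = u powr p / 2" by (simp flip: powr_diff)
  finally show "u\<^sup>2 / (2 * (K + u powr (2 - p))) \<le> u powr p / 2" .
qed

theorem proposition2p4:
  fixes M :: "'a measure" and X :: "nat \<Rightarrow> 'a \<Rightarrow> real"
    and n :: nat and \<alpha> p K :: real
  assumes "prob_space M"
    and "negatively_associated_seq M X"
    and "\<And>i. i \<ge> 1 \<Longrightarrow> integrable M (X i)"
    and "\<And>i. i \<ge> 1 \<Longrightarrow> (LINT \<omega>|M. X i \<omega>) = 0"
    and "n \<ge> 1"
    and "0 < \<alpha>" and "\<alpha> < 1"
    and "0 < p" and "p < 1"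
    and "K \<ge> 1"
    and "(\<Sum>i=1..n. \<integral>\<^sup>+\<omega>. ennreal ((X i \<omega>)\<^sup>2 * exp (\<bar>X i \<omega>\<bar> powr p)) \<partial>M) \<le> ennreal K"
  shows
    "(\<forall>x>0.
        (0 \<le> \<alpha> * x \<and> \<alpha> * x \<le> K powr (1 / (2 - p)) \<longrightarrow>
           \<P>(\<omega> in M. (MAX k\<in>{1..n}. \<Sum>i=1..k. X i \<omega>) \<ge> x)
             \<le> 2 / (1 - \<alpha>) * exp (- (\<alpha>\<^sup>2 * x\<^sup>2 / (2 * K))) \<and>
           2 / (1 - \<alpha>) * exp (- (\<alpha>\<^sup>2 * x\<^sup>2 / (2 * K)))
             \<le> 2 / (1 - \<alpha>) * exp (- (\<alpha>\<^sup>2 * x\<^sup>2 / (2 * (K + \<alpha> powr (2 - p) * x powr (2 - p)))))) \<and>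
        (\<alpha> * x \<ge> K powr (1 / (2 - p)) \<longrightarrow>
           \<P>(\<omega> in M. (MAX k\<in>{1..n}. \<Sum>i=1..k. X i \<omega>) \<ge> x)
             \<le> 2 / (1 - \<alpha>) * exp (- (\<alpha> powr p * x powr p / 2)) \<and>
           2 / (1 - \<alpha>) * exp (- (\<alpha> powr p * x powr p / 2))
             \<le> 2 / (1 - \<alpha>) * exp (- (\<alpha>\<^sup>2 * x\<^sup>2 / (2 * (K + \<alpha> powr (2 - p) * x powr (2 - p))))))) \<and>
     (\<forall>x>0.
        (0 \<le> x \<and> x \<le> 2 * K powr (1 / (2 - p)) \<longrightarrow>
           \<P>(\<omega> in M. (MAX k\<in>{1..n}. \<Sum>i=1..k. X i \<omega>) \<ge> x)
             \<le> 4 * exp (- (x\<^sup>2 / (8 * K))) \<and>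
           4 * exp (- (x\<^sup>2 / (8 * K)))
             \<le> 4 * exp (- (x\<^sup>2 / (8 * K + 2 powr (p + 1) * x powr (2 - p))))) \<and>
        (x \<ge> 2 * K powr (1 / (2 - p)) \<longrightarrow>
           \<P>(\<omega> in M. (MAX k\<in>{1..n}. \<Sum>i=1..k. X i \<omega>) \<ge> x)
             \<le> 4 * exp (- (x powr p / 2 powr (p + 1))) \<and>
           4 * exp (- (x powr p / 2 powr (p + 1)))
             \<le> 4 * exp (- (x\<^sup>2 / (8 * K + 2 powr (p + 1) * x powr (2 - p))))))"
proof -
  interpret prob_space M by fact
  have exps: "b\<^sup>2 * x\<^sup>2 / (2 * (K + b powr (2 - p) * x powr (2 - p))) \<le> b\<^sup>2 * x\<^sup>2 / (2 * K)"
    "b\<^sup>2 * x\<^sup>2 / (2 * (K + b powr (2 - p) * x powr (2 - p))) \<le> b powr p * x powr p / 2"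
    if "0 < x" "0 < b" for x b :: real
    using regime_exponents_ge[of K "b * x" p] that \<open>K \<ge> 1\<close>
    by (simp_all add: powr_mult power_mult_distrib)
  \<comment> \<open>The parameter \<open>a\<close> stays free here: it is taken as
    \<open>\<alpha>\<close> for the general bounds and as \<open>1 / 2\<close> for the particular
    case.\<close>
  note bounds = negatively_associated_max_prob_bounds[OF assms(2-5,8-11)]
  have half1: "2 / (1 - 1 / 2) * exp (- ((1 / 2)\<^sup>2 * x\<^sup>2 / (2 * K))) = 4 * exp (- (x\<^sup>2 / (8 * K)))"
    for x :: real
    by (simp add: power2_eq_square)
  have half2: "(1 / 2) powr p * x powr p / 2 = x powr p / 2 powr (p + 1)" for x :: real
    by (simp add: powr_divide powr_add)
  have half3: "(1 / 2)\<^sup>2 * x\<^sup>2 / (2 * (K + (1 / 2) powr (2 - p) * x powr (2 - p)))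
      = x\<^sup>2 / (8 * K + 2 powr (p + 1) * x powr (2 - p))" for x :: real
  proof -
    have "8 * (1 / 2) powr (2 - p) = (2 powr (p + 1) :: real)"
      by (simp add: powr_divide powr_diff powr_add)
    then have "8 * (K + (1 / 2) powr (2 - p) * x powr (2 - p))
        = 8 * K + 2 powr (p + 1) * x powr (2 - p)"
      by (metis distrib_left mult.assoc)
    then show ?thesis by (simp add: power2_eq_square)
  qed
  show ?thesis
  proof (intro conjI allI impI)
    fix x :: real assume x: "0 < x"
    show "4 * exp (- (x\<^sup>2 / (8 * K))) \<le> 4 * exp (- (x\<^sup>2 / (8 * K + 2 powr (p + 1) * x powr (2 - p))))"
      using exps(1)[OF x, of "1 / 2"] unfolding half3 by (simp add: power2_eq_square)
    show "4 * exp (- (x powr p / 2 powr (p + 1)))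
        \<le> 4 * exp (- (x\<^sup>2 / (8 * K + 2 powr (p + 1) * x powr (2 - p))))"
      using exps(2)[OF x, of "1 / 2"] unfolding half3 half2 by simp
    show "\<P>(\<omega> in M. (MAX k\<in>{1..n}. \<Sum>i=1..k. X i \<omega>) \<ge> x) \<le> 4 * exp (- (x\<^sup>2 / (8 * K)))"
      if "0 \<le> x \<and> x \<le> 2 * K powr (1 / (2 - p))"
      using bounds(1)[of "1 / 2" x] that x unfolding half1 by simp
    show "\<P>(\<omega> in M. (MAX k\<in>{1..n}. \<Sum>i=1..k. X i \<omega>) \<ge> x) \<le> 4 * exp (- (x powr p / 2 powr (p + 1)))"
      if "2 * K powr (1 / (2 - p)) \<le> x"
      using bounds(2)[of "1 / 2" x] that x unfolding half2 by simp
    have c: "0 \<le> 2 / (1 - \<alpha>)" using \<open>\<alpha> < 1\<close> by simp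
    show "2 / (1 - \<alpha>) * exp (- (\<alpha>\<^sup>2 * x\<^sup>2 / (2 * K)))
        \<le> 2 / (1 - \<alpha>) * exp (- (\<alpha>\<^sup>2 * x\<^sup>2 / (2 * (K + \<alpha> powr (2 - p) * x powr (2 - p)))))"
      using exps(1)[OF x \<open>0 < \<alpha>\<close>] by (intro mult_left_mono[OF _ c]) (simp only: exp_le_cancel_iff neg_le_iff_le)
    show "2 / (1 - \<alpha>) * exp (- (\<alpha> powr p * x powr p / 2))
        \<le> 2 / (1 - \<alpha>) * exp (- (\<alpha>\<^sup>2 * x\<^sup>2 / (2 * (K + \<alpha> powr (2 - p) * x powr (2 - p)))))"
      using exps(2)[OF x \<open>0 < \<alpha>\<close>] by (intro mult_left_mono[OF _ c]) (simp only: exp_le_cancel_iff neg_le_iff_le)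
  qed (use bounds assms in auto)
qed

end
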